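(* One has $h(k)=\Omega(k\log k)$ for $k\ge 4$; that is, there is an absolute constant $c>0$ such that $h(k)\ge c\,k\log k$ for every integer $k\geq 4$.
   Context: All digraphs are finite and simple (no loops, no multiple arcs). A tournament is a digraph obtained by assigning a direction to each edge of an undirected complete graph; its order is its number of vertices. A rooted tree is a directed tree with a special vertex, the root, such that there is a unique directed path from the root to any other vertex; the children of a vertex in a rooted tree are its out-neighbors in the tree, and a leaf is a vertex of out-degree zero in the tree. For a positive integer $k$, a rooted tree is called a $k$-ary tree if all non-leaf vertices have exactly $k$ children, except that possibly one non-leaf vertex has at most $k-1$ children. A tournament $T$ contains a $k$-ary spanning tree if some subdigraph of $T$ that contains all vertices of $T$ is a $k$-ary tree. Define $h(k)$ as the minimum positive integer such that every tournament of order at least $h(k)$ contains a $k$-ary spanning tree; it is a known theorem (Lu et al.) that $h(k)$ exists (is finite) for every positive integer $k$. *)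

theory Defs
  imports
    Complex_Main
    "HOL-Library.Extended_Real"
    "Graph_Theory.Digraph_Component"
begin

locale tournament = digraph T for T :: "('a, 'b) pre_digraph" (structure) +
  assumes one_direction:
    "\<lbrakk>u \<in> verts T; v \<in> verts T; u \<noteq> v\<rbrakk> \<Longrightarrow> (u \<rightarrow>\<^bsub>T\<^esub> v) \<noteq> (v \<rightarrow>\<^bsub>T\<^esub> u)"

text \<open>
  An orientation of an undirected tree. The library constant \<^const>\<open>forest\<close> only excludes
  directed cycles, so acyclicity is required here of the underlying undirected graph, which is
  represented by the symmetric digraph \<^const>\<open>mk_symmetric\<close>; there a closed walk
  \<open>a, b, a\<close> counts as a cycle of length 2, whence the bound 3 on the length.
\<close>

definition directed_tree :: "('a, 'b) pre_digraph \<Rightarrow> bool" where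
  "directed_tree H \<longleftrightarrow>
     digraph H \<and>
     (\<forall>u v. u \<rightarrow>\<^bsub>H\<^esub> v \<longrightarrow> \<not> v \<rightarrow>\<^bsub>H\<^esub> u) \<and>
     connected H \<and>
     \<not> (\<exists>p. pre_digraph.cycle (with_proj (mk_symmetric H)) p \<and> 3 \<le> length p)"

definition rooted_tree :: "('a, 'b) pre_digraph \<Rightarrow> 'a \<Rightarrow> bool" where
  "rooted_tree H r \<longleftrightarrow>
     directed_tree H \<and> r \<in> verts H \<and>
     (\<forall>v \<in> verts H - {r}. \<exists>!p. pre_digraph.apath H r p v)"

definition children :: "('a, 'b) pre_digraph \<Rightarrow> 'a \<Rightarrow> 'a set" where
  "children H v = {w. v \<rightarrow>\<^bsub>H\<^esub> w}"

definition non_leaves :: "('a, 'b) pre_digraph \<Rightarrow> 'a set" where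
  "non_leaves H = {v \<in> verts H. out_degree H v \<noteq> 0}"

definition kary_tree :: "nat \<Rightarrow> ('a, 'b) pre_digraph \<Rightarrow> bool" where
  "kary_tree k H \<longleftrightarrow>
     (\<exists>r. rooted_tree H r) \<and>
     ((\<forall>v \<in> non_leaves H. card (children H v) = k) \<or>
      (\<exists>w \<in> non_leaves H. card (children H w) \<le> k - 1 \<and>
         (\<forall>v \<in> non_leaves H - {w}. card (children H v) = k)))"

definition has_kary_spanning_tree :: "nat \<Rightarrow> ('a, 'b) pre_digraph \<Rightarrow> bool" where
  "has_kary_spanning_tree k T \<longleftrightarrow> (\<exists>H. spanning H T \<and> kary_tree k H)"

text \<open>
  The minimum is taken in \<^typ>\<open>enat\<close>. The set is nonempty for every \<open>k \<ge> 1\<close> by a theorem of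
  Lu et al., so that the infimum is its least element; the choice of \<^typ>\<open>enat\<close> only avoids
  making the definition depend on that theorem. Every finite digraph is isomorphic to one with
  vertices in \<^typ>\<open>nat\<close> and arcs in \<^typ>\<open>nat \<times> nat\<close>.
\<close>

definition kary_h :: "nat \<Rightarrow> enat" where
  "kary_h k = Inf {enat n | n. 0 < n \<and>
     (\<forall>T :: (nat, nat \<times> nat) pre_digraph.
        tournament T \<and> n \<le> card (verts T) \<longrightarrow> has_kary_spanning_tree k T)}"

end

theory Submission
  imports Defs "HOL-Real_Asymp.Real_Asymp"
begin

text \<open>
  The non-leaves of a \<open>k\<close>-ary spanning tree form a dominating set of the tournament, and if the
  order is at most \<open>k m\<close> then there are at most \<open>m\<close> of them. A uniformly random tournament on
  \<open>k m\<close> vertices has, with positive probability, no dominating set of size \<open>m\<close>, provided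
  \<open>2 ^ m * ln (k m) < k - 1\<close>. This allows \<open>m\<close> to be about \<open>log 2 k / 2\<close>.
\<close>

section \<open>Non-leaves of rooted trees\<close>

text \<open>Replacing each arc by its pair of ends turns a directed cycle of \<open>H\<close> into a
  cycle of \<open>mk_symmetric H\<close>. The definition forbids the latter only from length 3 on,
  so lengths 1 and 2 are excluded separately, by the absence of loops and of opposite arcs.\<close>

lemma directed_tree_no_cycle:
  assumes H: "directed_tree H"
  shows "\<not> pre_digraph.cycle H p"
proof
  assume "pre_digraph.cycle H p"
  interpret digraph H
    using H by (simp add: directed_tree_def)
  from \<open>cycle p\<close> obtain u where u: "awalk u p u" "distinct (tl (awalk_verts u p))" "p \<noteq> []"
    unfolding cycle_def by blast
  interpret S: pair_wf_digraph "mk_symmetric H" ..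
  let ?q = "map (arc_to_ends H) p"
  have verts_eq: "pawalk_verts x (map (arc_to_ends H) q) = awalk_verts x q" for x q
    by (induction q arbitrary: x) (auto simp: arc_to_ends_def)
  have cas_eq: "pcas x (map (arc_to_ends H) q) y = cas x q y" for x q y
    by (induction q arbitrary: x) (auto simp: arc_to_ends_def)
  have "pre_digraph.awalk (mk_symmetric H) u ?q u"
    using u(1) unfolding pre_digraph.awalk_def
    by (auto simp: cas_eq parcs_mk_symmetric arc_to_ends_def)
  then have "pre_digraph.cycle (mk_symmetric H) ?q"
    unfolding pre_digraph.cycle_def using u by (auto simp: verts_eq)
  moreover have "3 \<le> length ?q"
  proof (rule ccontr)
    assume "\<not> 3 \<le> length ?q"
    then consider a where "p = [a]" | a b where "p = [a, b]"
      using u(3) by (cases p; cases "tl p"; cases "tl (tl p)") auto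
    then show False
    proof cases
      case 1
      then show False using u(1) no_loops[of a] by (auto simp: awalk_def)
    next
      case 2
      then have "tail H a \<rightarrow>\<^bsub>H\<^esub> head H a" "head H a \<rightarrow>\<^bsub>H\<^esub> tail H a"
        using u(1) by (auto simp: awalk_def arcs_ends_conv intro: rev_image_eqI)
      then show False using H by (auto simp: directed_tree_def)
    qed
  qed
  ultimately show False
    using H by (auto simp: directed_tree_def)
qed

section \<open>Parents and children in a rooted tree\<close>

locale rooted_tree_digraph =
  fixes H :: "('a, 'b) pre_digraph" (structure) and r
  assumes rooted: "rooted_tree H r"

sublocale rooted_tree_digraph \<subseteq> digraph H
  using rooted by (simp add: rooted_tree_def directed_tree_def)

context rooted_tree_digraph
begin

lemma root_in_verts: "r \<in> verts H"
  using rooted by (simp add: rooted_tree_def)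

lemma apath_from_root: "\<exists>p. apath r p v" if "v \<in> verts H"
proof (cases "v = r")
  case True
  then show ?thesis using that apath_Nil_iff by blast
next
  case False
  then show ?thesis using that rooted by (auto simp: rooted_tree_def)
qed

lemma apath_from_root_unique: "apath r p v \<Longrightarrow> apath r q v \<Longrightarrow> v \<noteq> r \<Longrightarrow> p = q"
  using rooted awalk_last_in_verts[of r p v] unfolding rooted_tree_def apath_def by blast

lemma acyclic: "\<not> v \<rightarrow>\<^sup>+ v"
proof
  assume "v \<rightarrow>\<^sup>+ v"
  then obtain p where "awalk v p v" "p \<noteq> []"
    using reachable1_awalk by blast
  then have "\<exists>p. cycle p"
    by (intro closed_w_imp_cycle[of p]) (auto simp: closed_w_def)
  then show False
    using rooted directed_tree_no_cycle by (auto simp: rooted_tree_def)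
qed

text \<open>If the head of \<open>a\<close> already lay on the path, it would reach the tail of
  \<open>a\<close>, and \<open>a\<close> would close a directed cycle.\<close>

lemma apath_snoc:
  assumes "apath r p (tail H a)" "a \<in> arcs H"
  shows "apath r (p @ [a]) (head H a)"
proof -
  have "head H a \<notin> set (awalk_verts r p)"
  proof
    assume "head H a \<in> set (awalk_verts r p)"
    then have "head H a \<rightarrow>\<^sup>* tail H a"
      using assms(1) awalk_verts_reachable_to unfolding apath_def by blast
    moreover have "tail H a \<rightarrow>\<^bsub>H\<^esub> head H a"
      using assms(2) by (auto simp: arcs_ends_conv)
    ultimately show False
      using acyclic[of "tail H a"] reachable1_reachable_trans by blast
  qed
  moreover have "tail H a = awlast r p" "tail H a \<in> verts H"
    using assms unfolding apath_def by auto
  ultimately show ?thesis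
    using assms by (auto simp: apath_append_iff apath_simps dest: no_loops)
qed

text \<open>The root reaches \<open>u\<close>, so an arc back to the root would close a directed
  cycle.\<close>

lemma no_arc_to_root: "\<not> u \<rightarrow>\<^bsub>H\<^esub> r"
proof
  assume ur: "u \<rightarrow>\<^bsub>H\<^esub> r"
  then have "u \<in> verts H" by (rule adj_in_verts)
  then obtain p where "apath r p u" using apath_from_root by blast
  then have "r \<rightarrow>\<^sup>* u" unfolding apath_def by (auto intro: reachable_awalkI)
  then show False
    using ur acyclic reachable_reachable1_trans by blast
qed

text \<open>Paths from the root to the two parents extend to paths to \<open>v\<close>. Since
  \<open>v\<close> is not the root, these coincide, and so do their last arcs.\<close>

lemma parent_unique:
  assumes "u \<rightarrow>\<^bsub>H\<^esub> v" "w \<rightarrow>\<^bsub>H\<^esub> v"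
  shows "u = w"
proof -
  obtain a b where a: "a \<in> arcs H" "tail H a = u" "head H a = v"
    and b: "b \<in> arcs H" "tail H b = w" "head H b = v"
    using assms by (metis reachableE)
  obtain p q where "apath r p u" "apath r q w"
    using apath_from_root assms adj_in_verts by blast
  then have "apath r (p @ [a]) v" "apath r (q @ [b]) v"
    using a b apath_snoc by metis+
  moreover have "v \<noteq> r" using assms no_arc_to_root by blast
  ultimately have "p @ [a] = q @ [b]" using apath_from_root_unique by blast
  then show ?thesis using a b by auto
qed

lemma parent_exists:
  assumes "v \<in> verts H" "v \<noteq> r"
  shows "\<exists>u. u \<rightarrow>\<^bsub>H\<^esub> v"
proof -
  obtain p where "apath r p v" using apath_from_root assms by blast
  then have "r \<rightarrow>\<^sup>* v" unfolding apath_def by (auto intro: reachable_awalkI)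
  then have "r \<rightarrow>\<^sup>+ v" using assms by blast
  then show ?thesis by (meson tranclD2)
qed

lemma non_leaf_iff: "v \<in> non_leaves H \<longleftrightarrow> children H v \<noteq> {}"
  unfolding non_leaves_def out_degree_def children_def arcs_ends_conv
  by (auto simp: card_eq_0_iff finite_out_arcs out_arcs_def)

lemma finite_non_leaves: "finite (non_leaves H)"
  unfolding non_leaves_def by simp

lemma children_subset: "children H v \<subseteq> verts H - {r}"
  using no_arc_to_root adj_in_verts by (auto simp: children_def)

text \<open>Child sets are disjoint because parents are unique, and all of them miss the root. The
  root makes the inequality strict, which later pays for the exceptional non-leaf.\<close>

lemma sum_card_children_less: "(\<Sum>v\<in>non_leaves H. card (children H v)) < card (verts H)"
proof -
  have fin: "finite (children H v)" for v
    using children_subset by (rule finite_subset) simp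
  have "(\<Sum>v\<in>non_leaves H. card (children H v)) = card (\<Union>v\<in>non_leaves H. children H v)"
    using fin finite_non_leaves parent_unique
    by (intro card_UN_disjoint[symmetric]) (auto simp: children_def)
  also have "\<dots> \<le> card (verts H - {r})"
    using children_subset by (intro card_mono) auto
  also have "\<dots> < card (verts H)"
    using root_in_verts by (intro psubset_card_mono) auto
  finally show ?thesis .
qed

text \<open>A vertex other than the root has a parent, which is a non-leaf. The root itself is a
  non-leaf as soon as there is a second vertex; in a one-vertex tree the set of non-leaves is
  empty.\<close>

lemma non_leaves_dominate:
  assumes "2 \<le> card (verts H)" "v \<in> verts H - non_leaves H"
  shows "\<exists>u\<in>non_leaves H. u \<rightarrow>\<^bsub>H\<^esub> v"
proof (cases "v = r")
  case False
  then obtain u where u: "u \<rightarrow>\<^bsub>H\<^esub> v" using parent_exists assms by blast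
  then have "u \<in> non_leaves H" by (auto simp: non_leaf_iff children_def)
  with u show ?thesis by (rule rev_bexI[rotated])
next
  case True
  have "\<not> verts H \<subseteq> {r}"
    using assms(1) card_mono[of "{r}" "verts H"] by force
  then obtain w where w: "w \<in> verts H" "w \<noteq> r" by blast
  obtain p where "apath r p w" using apath_from_root w by blast
  then have "r \<rightarrow>\<^sup>* w" unfolding apath_def by (auto intro: reachable_awalkI)
  then have "r \<rightarrow>\<^sup>+ w" using w by blast
  then have "children H r \<noteq> {}" by (auto simp: children_def dest: tranclD)
  then show ?thesis using True assms non_leaf_iff by blast
qed

end

section \<open>From spanning trees to small dominating sets\<close>

lemma kary_tree_card_non_leaves:
  assumes "kary_tree k H" and n: "card (verts H) \<le> k * m"
  shows "card (non_leaves H) \<le> m"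
proof -
  obtain r where "rooted_tree H r" using assms by (auto simp: kary_tree_def)
  then interpret rooted_tree_digraph H r by unfold_locales
  have "0 < card (verts H)"
    using root_in_verts by (auto simp: card_gt_0_iff)
  then have "0 < k" using n by (cases k) auto
  consider "\<forall>v \<in> non_leaves H. card (children H v) = k"
    | w where "w \<in> non_leaves H" "\<forall>v \<in> non_leaves H - {w}. card (children H v) = k"
    using assms(1) unfolding kary_tree_def by blast
  then show ?thesis
  proof cases
    case 1
    then have "k * card (non_leaves H) < k * m"
      using less_le_trans[OF sum_card_children_less n] by (simp add: mult.commute)
    then show ?thesis by simp
  next
    case 2
    then have "(\<Sum>v\<in>non_leaves H. card (children H v))
        = card (children H w) + k * card (non_leaves H - {w})"
      using finite_non_leaves by (simp add: sum.remove mult.commute)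
    \<comment> \<open>Even if \<open>w\<close> is credited with no children, strictness leaves at
      most \<open>m - 1\<close> non-leaves besides \<open>w\<close>, hence at most \<open>m\<close>
      with it.\<close>
    then have "k * card (non_leaves H - {w}) < k * m"
      using sum_card_children_less n by linarith
    then have "card (non_leaves H) - 1 < m" using 2 by (simp add: card_Diff_singleton)
    then show ?thesis by linarith
  qed
qed

text \<open>The set is \<open>non_leaves H\<close> for a spanning tree \<open>H\<close>: domination
  passes from \<open>H\<close> to \<open>T\<close> because the vertices agree and every arc of
  \<open>H\<close> joins vertices adjacent in \<open>T\<close> in the same direction.\<close>

lemma has_kary_spanning_tree_imp_dominating_set:
  assumes "has_kary_spanning_tree k T" "2 \<le> card (verts T)" "card (verts T) \<le> k * m"
  shows "\<exists>S\<subseteq>verts T. card S \<le> m \<and> (\<forall>v\<in>verts T - S. \<exists>u\<in>S. u \<rightarrow>\<^bsub>T\<^esub> v)"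
proof -
  obtain H where H: "spanning H T" "kary_tree k H"
    using assms(1) by (auto simp: has_kary_spanning_tree_def)
  then have V: "verts H = verts T" and arcs: "arcs_ends H \<subseteq> arcs_ends T"
    by (auto simp: spanning_def dest: arcs_ends_mono)
  obtain r where "rooted_tree H r" using H by (auto simp: kary_tree_def)
  then interpret rooted_tree_digraph H r by unfold_locales
  have "card (non_leaves H) \<le> m"
    using H(2) assms(3) V kary_tree_card_non_leaves by metis
  moreover have "non_leaves H \<subseteq> verts T"
    using V by (auto simp: non_leaves_def)
  moreover have "\<exists>u\<in>non_leaves H. u \<rightarrow>\<^bsub>T\<^esub> v" if "v \<in> verts T - non_leaves H" for v
    using non_leaves_dominate[of v] that assms(2) arcs V by auto
  ultimately show ?thesis by blast
qed

section \<open>Tournaments without small dominating sets\<close>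

text \<open>Independence in counting form. For a uniformly random \<open>E\<close> in
  \<open>Pow P\<close>, the trace on \<open>F v\<close> is uniform among \<open>2 ^ m\<close> sets,
  so it misses the single value \<open>G v\<close> with probability \<open>1 - 1 / 2 ^ m\<close>;
  disjointness of the blocks multiplies these factors.\<close>

lemma card_subsets_avoiding_traces:
  assumes "finite R" "finite P" "\<And>v. v \<in> R \<Longrightarrow> F v \<subseteq> P" "\<And>v. v \<in> R \<Longrightarrow> card (F v) = m"
    "\<And>v. v \<in> R \<Longrightarrow> G v \<subseteq> F v" "disjoint_family_on F R"
  shows "real (card {E \<in> Pow P. \<forall>v\<in>R. E \<inter> F v \<noteq> G v}) = (1 - 1 / 2 ^ m) ^ card R * 2 ^ card P"
  using assms
proof (induction R arbitrary: P rule: finite_induct)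
  case empty
  then show ?case by (simp flip: Pow_def add: card_Pow)
next
  case (insert v R)
  define P' where "P' = P - F v"
  define A where "A = {E \<in> Pow P. \<forall>w\<in>insert v R. E \<inter> F w \<noteq> G w}"
  define B where "B = {E \<in> Pow P'. \<forall>w\<in>R. E \<inter> F w \<noteq> G w}"
  have disj: "F w \<inter> F v = {}" if "w \<in> R" for w
    using insert.prems(5) insert.hyps(2) that unfolding disjoint_family_on_def by (metis insertCI)
  have Fv: "F v \<subseteq> P" "card (F v) = m" "G v \<subseteq> F v" "finite (F v)"
    using insert.prems finite_subset[of "F v" P] by auto
  have IH: "real (card B) = (1 - 1 / 2 ^ m) ^ card R * 2 ^ card P'"
    unfolding B_def
  proof (rule insert.IH)
    show "F w \<subseteq> P'" if "w \<in> R" for w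
      using disj[OF that] insert.prems(2)[of w] that by (auto simp: P'_def)
    show "disjoint_family_on F R"
      using insert.prems(5) by (auto simp: disjoint_family_on_def)
  qed (use insert.prems in \<open>auto simp: P'_def\<close>)
  \<comment> \<open>Splitting \<open>E\<close> into its trace on \<open>F v\<close> and the
    remainder separates the conditions: the first part avoids one subset of \<open>F v\<close>, the
    second is counted by the induction hypothesis on \<open>P'\<close>.\<close>
  have "bij_betw (\<lambda>(X, Y). X \<union> Y) ((Pow (F v) - {G v}) \<times> B) A"
  proof (rule bij_betw_byWitness[where f' = "\<lambda>E. (E \<inter> F v, E - F v)"])
    show "\<forall>a\<in>(Pow (F v) - {G v}) \<times> B. (\<lambda>E. (E \<inter> F v, E - F v)) ((\<lambda>(X, Y). X \<union> Y) a) = a"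
      by (auto simp: B_def P'_def)
    show "\<forall>a'\<in>A. (\<lambda>(X, Y). X \<union> Y) ((\<lambda>E. (E \<inter> F v, E - F v)) a') = a'"
      by auto
    have trace: "(X \<union> Y) \<inter> F w = Y \<inter> F w" if "X \<subseteq> F v" "w \<in> R" for X Y w
      using disj[OF that(2)] that(1) by blast
    have part: "(X \<union> Y) \<inter> F v = X" if "X \<subseteq> F v" "Y \<subseteq> P'" for X Y
      using that by (auto simp: P'_def)
    show "(\<lambda>(X, Y). X \<union> Y) ` ((Pow (F v) - {G v}) \<times> B) \<subseteq> A"
      using Fv(1) by (auto simp: A_def B_def trace part) (auto simp: P'_def)
    have trace_diff: "(E - F v) \<inter> F w = E \<inter> F w" if "w \<in> R" for E w
      using disj[OF that] by blast
    show "(\<lambda>E. (E \<inter> F v, E - F v)) ` A \<subseteq> (Pow (F v) - {G v}) \<times> B"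
      by (auto simp: A_def B_def P'_def trace_diff)
  qed
  then have "card A = card (Pow (F v) - {G v}) * card B"
    by (metis bij_betw_same_card card_cartesian_product)
  also have "card (Pow (F v) - {G v}) = 2 ^ m - 1"
    using Fv by (simp add: card_Pow)
  finally have "real (card A) = (2 ^ m - 1) * real (card B)"
    by (simp add: of_nat_diff)
  moreover have "card P = m + card P'"
    unfolding P'_def using Fv insert.prems(1) card_mono[of P "F v"] by (simp add: card_Diff_subset)
  ultimately show ?case
    unfolding A_def[symmetric] using insert.hyps IH by (simp add: power_add diff_divide_distrib algebra_simps)
qed

section \<open>Random tournaments as random sets of pairs\<close>

definition beats :: "(nat \<times> nat) set \<Rightarrow> nat \<Rightarrow> nat \<Rightarrow> bool" where
  "beats E u v \<longleftrightarrow> (if u < v then (u, v) \<in> E else (v, u) \<notin> E)"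

text \<open>Membership of \<open>(i, j)\<close> with \<open>i < j\<close> in \<open>E\<close>
  decides the direction between \<open>i\<close> and \<open>j\<close>. Counting subsets of the pairs
  \<open>i < j < n\<close> therefore replaces a uniform measure on tournaments.\<close>

definition tournament_of :: "nat \<Rightarrow> (nat \<times> nat) set \<Rightarrow> (nat, nat \<times> nat) pre_digraph" where
  "tournament_of n E = \<lparr>verts = {..<n},
     arcs = {(u, v). u < n \<and> v < n \<and> u \<noteq> v \<and> beats E u v}, tail = fst, head = snd\<rparr>"

text \<open>The unordered pair in the sorted form in which \<open>beats\<close> looks it up in
  \<open>E\<close>.\<close>

definition edge :: "nat \<Rightarrow> nat \<Rightarrow> nat \<times> nat" where
  "edge u v = (min u v, max u v)"

lemma edge_eq_iff: "edge u v = edge x y \<longleftrightarrow> u = x \<and> v = y \<or> u = y \<and> v = x"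
  unfolding edge_def by (cases "u \<le> v"; cases "x \<le> y") auto

lemma adj_tournament_of:
  "u \<rightarrow>\<^bsub>tournament_of n E\<^esub> v \<longleftrightarrow> u < n \<and> v < n \<and> u \<noteq> v \<and> beats E u v"
  by (auto simp: tournament_of_def arcs_ends_conv)

lemma tournament_tournament_of: "tournament (tournament_of n E)"
proof
  have "arcs (tournament_of n E) \<subseteq> {..<n} \<times> {..<n}"
    by (auto simp: tournament_of_def)
  then show "finite (arcs (tournament_of n E))"
    by (rule finite_subset) simp
  show "(u \<rightarrow>\<^bsub>tournament_of n E\<^esub> v) \<noteq> (v \<rightarrow>\<^bsub>tournament_of n E\<^esub> u)"
    if "u \<in> verts (tournament_of n E)" "v \<in> verts (tournament_of n E)" "u \<noteq> v" for u v
    using that by (auto simp: adj_tournament_of beats_def) (auto simp: tournament_of_def)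
qed (auto simp: tournament_of_def arc_to_ends_def)

text \<open>Union bound over \<open>S\<close>: for fixed \<open>S\<close> the events that \<open>v\<close> beats all of \<open>S\<close>, for
  \<open>v \<notin> S\<close>, depend on disjoint sets of pairs, and each has probability \<open>1 / 2 ^ m\<close>.\<close>

lemma ex_tournament_all_sets_beaten:
  assumes "m \<le> n" and small: "real n ^ m * (1 - 1 / 2 ^ m) ^ (n - m) < 1"
  shows "\<exists>E. \<forall>S\<subseteq>{..<n}. card S = m \<longrightarrow> (\<exists>v\<in>{..<n} - S. \<forall>s\<in>S. beats E v s)"
proof (rule ccontr)
  assume neg: "\<not> ?thesis"
  define P where "P = {(i, j). i < j \<and> j < n}"
  \<comment> \<open>\<open>bad S\<close> consists of the orientations in which \<open>S\<close>
    dominates: no outside vertex beats all of \<open>S\<close>.\<close>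
  define bad where "bad S = {E \<in> Pow P. \<forall>v\<in>{..<n} - S. \<not> (\<forall>s\<in>S. beats E v s)}" for S
  define \<S> where "\<S> = {S. S \<subseteq> {..<n} \<and> card S = m}"
  have "P \<subseteq> {..<n} \<times> {..<n}" by (auto simp: P_def)
  then have finP: "finite P" by (rule finite_subset) simp
  have card_bad: "real (card (bad S)) = (1 - 1 / 2 ^ m) ^ (n - m) * 2 ^ card P" if "S \<in> \<S>" for S
  proof -
    have S: "S \<subseteq> {..<n}" "card S = m" using that by (auto simp: \<S>_def)
    \<comment> \<open>\<open>F v\<close> holds the pairs joining \<open>v\<close> to
      \<open>S\<close>, and \<open>G v\<close> those in which \<open>v\<close> is the smaller end.
      \<open>G v\<close> is the one trace on \<open>F v\<close> for which \<open>v\<close> beats all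
      of \<open>S\<close>.\<close>
    define F where "F v = edge v ` S" for v
    define G where "G v = edge v ` {s \<in> S. v < s}" for v
    have iff: "(\<forall>s\<in>S. beats E v s) \<longleftrightarrow> E \<inter> F v = G v" if "v \<in> {..<n} - S" for v E
    proof -
      have "v \<notin> S" using that by simp
      then have "beats E v s \<longleftrightarrow> (edge v s \<in> E \<longleftrightarrow> v < s)" if "s \<in> S" for s
        using that by (cases v s rule: linorder_cases) (auto simp: beats_def edge_def)
      moreover have "edge v s \<in> G v \<longleftrightarrow> v < s" if "s \<in> S" for s
        using that \<open>v \<notin> S\<close> by (auto simp: G_def edge_eq_iff)
      moreover have "G v \<subseteq> F v" by (auto simp: F_def G_def)
      ultimately show ?thesis unfolding F_def by blast
    qed
    have "real (card {E \<in> Pow P. \<forall>v\<in>{..<n} - S. E \<inter> F v \<noteq> G v})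
        = (1 - 1 / 2 ^ m) ^ card ({..<n} - S) * 2 ^ card P"
    proof (rule card_subsets_avoiding_traces)
      show "F v \<subseteq> P" if "v \<in> {..<n} - S" for v
      proof
        fix x assume "x \<in> F v"
        then obtain s where s: "s \<in> S" "x = edge v s" by (auto simp: F_def)
        then have "s < n" "v < n" "v \<noteq> s" using S(1) that by auto
        then show "x \<in> P"
          using s by (cases v s rule: linorder_cases) (auto simp: P_def edge_def)
      qed
      show "card (F v) = m" if "v \<in> {..<n} - S" for v
        unfolding F_def S(2)[symmetric]
        by (rule card_image) (auto simp: inj_on_def edge_eq_iff)
      show "G v \<subseteq> F v" for v
        by (auto simp: F_def G_def)
      \<comment> \<open>A pair joining \<open>S\<close> to a vertex outside \<open>S\<close>
        determines that vertex.\<close>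
      show "disjoint_family_on F ({..<n} - S)"
        unfolding disjoint_family_on_def F_def by (auto simp: edge_eq_iff)
    qed (use finP in auto)
    moreover have "card ({..<n} - S) = n - m"
      using S by (simp add: card_Diff_subset finite_subset[OF S(1)])
    moreover have "bad S = {E \<in> Pow P. \<forall>v\<in>{..<n} - S. E \<inter> F v \<noteq> G v}"
      unfolding bad_def using iff by blast
    ultimately show ?thesis by simp
  qed
  \<comment> \<open>By the negated claim every orientation is bad for some \<open>S\<close>. The
    sizes of the sets \<open>bad S\<close> add up to less than the number of orientations, a
    contradiction.\<close>
  have "Pow P \<subseteq> (\<Union>S\<in>\<S>. bad S)"
  proof
    fix E assume "E \<in> Pow P"
    moreover obtain S where "S \<subseteq> {..<n}" "card S = m" "\<not> (\<exists>v\<in>{..<n} - S. \<forall>s\<in>S. beats E v s)"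
      using neg by blast
    ultimately show "E \<in> (\<Union>S\<in>\<S>. bad S)" by (auto simp: bad_def \<S>_def)
  qed
  moreover have fin: "finite \<S>" by (simp add: \<S>_def)
  moreover have "finite (bad S)" for S using finP by (simp add: bad_def)
  ultimately have "card (Pow P) \<le> card (\<Union>S\<in>\<S>. bad S)"
    by (intro card_mono finite_UN_I)
  also have "\<dots> \<le> (\<Sum>S\<in>\<S>. card (bad S))"
    using fin by (rule card_UN_le)
  finally have "real (card (Pow P)) \<le> (\<Sum>S\<in>\<S>. real (card (bad S)))"
    by (metis of_nat_le_iff of_nat_sum)
  also have "\<dots> = real (n choose m) * ((1 - 1 / 2 ^ m) ^ (n - m) * 2 ^ card P)"
    using n_subsets[of "{..<n}" m] by (simp add: card_bad \<S>_def)
  also have "\<dots> \<le> real n ^ m * ((1 - 1 / 2 ^ m) ^ (n - m) * 2 ^ card P)"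
    using binomial_le_pow[OF assms(1)]
    by (intro mult_right_mono) (auto simp flip: of_nat_power)
  also have "\<dots> < 2 ^ card P"
    using small by (simp flip: mult.assoc)
  finally show False
    using finP by (simp add: card_Pow)
qed

text \<open>For \<open>n = k * m\<close> one has \<open>n - m = m * (k - 1)\<close>. With
  \<open>1 - x \<le> exp (- x)\<close> the union bound becomes the exponential of
  \<open>m * (ln n - (k - 1) / 2 ^ m)\<close>, which is below 1 exactly by the third
  hypothesis.\<close>

lemma ex_tournament_no_kary_spanning_tree:
  assumes "1 \<le> m" "2 \<le> k" "2 ^ m * ln (real (k * m)) < real k - 1"
  shows "\<exists>T :: (nat, nat \<times> nat) pre_digraph.
    tournament T \<and> card (verts T) = k * m \<and> \<not> has_kary_spanning_tree k T"
proof -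
  define n where "n = k * m"
  have n: "m \<le> n" "2 \<le> n"
    using assms(1,2) mult_le_mono[of 2 k 1 m] by (auto simp: n_def)
  have "(1 - 1 / 2 ^ m :: real) ^ (n - m) \<le> exp (- 1 / 2 ^ m) ^ (n - m)"
    using exp_ge_add_one_self[of "- 1 / 2 ^ m :: real"] by (intro power_mono) auto
  also have "\<dots> = exp (- (real (n - m) / 2 ^ m))"
    by (simp flip: exp_of_nat_mult)
  finally have "real n ^ m * (1 - 1 / 2 ^ m) ^ (n - m) \<le> real n ^ m * exp (- (real (n - m) / 2 ^ m))"
    by (intro mult_left_mono) auto
  also have "\<dots> = exp (real m * ln n - real (n - m) / 2 ^ m)"
    using n by (simp add: exp_of_nat_mult exp_diff exp_minus divide_inverse)
  also have "\<dots> < 1"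
  proof -
    have "real (n - m) = real m * (real k - 1)"
      using n by (simp add: of_nat_diff n_def algebra_simps)
    moreover have "ln (real n) < (real k - 1) / 2 ^ m"
      using assms(3) by (simp add: n_def field_simps)
    ultimately have "real m * ln n < real (n - m) / 2 ^ m"
      using assms(1) mult_strict_left_mono[of "ln n" "(real k - 1) / 2 ^ m" "real m"]
      by simp
    then show ?thesis by simp
  qed
  finally obtain E where E: "\<And>S. S \<subseteq> {..<n} \<Longrightarrow> card S = m \<Longrightarrow> \<exists>v\<in>{..<n} - S. \<forall>s\<in>S. beats E v s"
    using ex_tournament_all_sets_beaten[OF n(1)] by meson
  define T where "T = tournament_of n E"
  have V: "verts T = {..<n}" by (simp add: T_def tournament_of_def)
  have "\<not> has_kary_spanning_tree k T"
  proof
    assume "has_kary_spanning_tree k T"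
    then obtain S where S: "S \<subseteq> {..<n}" "card S \<le> m" "\<And>v. v \<in> {..<n} - S \<Longrightarrow> \<exists>u\<in>S. u \<rightarrow>\<^bsub>T\<^esub> v"
      using has_kary_spanning_tree_imp_dominating_set[of k T m] n V by (auto simp: n_def)
    \<comment> \<open>The counterexample speaks of sets of size exactly \<open>m\<close>, so
      \<open>S\<close> is padded. The vertex \<open>v\<close> beating \<open>S'\<close> lies outside
      \<open>S\<close>, yet some \<open>u\<close> in \<open>S\<close> would have to beat it.\<close>
    obtain S' where S': "S \<subseteq> S'" "S' \<subseteq> {..<n}" "card S' = m"
      using exists_subset_between[of S m "{..<n}"] S n by auto
    then obtain v where v: "v \<in> {..<n} - S'" "\<forall>s\<in>S'. beats E v s" using E by blast
    then obtain u where "u \<in> S" "u \<rightarrow>\<^bsub>T\<^esub> v" using S S' by blast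
    then have "u \<noteq> v" "beats E u v" "beats E v u"
      using v S' by (auto simp: T_def adj_tournament_of)
    then show False
      by (simp add: beats_def split: if_splits)
  qed
  then show ?thesis
    using tournament_tournament_of V unfolding T_def n_def by (metis card_lessThan)
qed

section \<open>The asymptotic lower bound\<close>

lemma kary_h_ge:
  assumes "1 \<le> m" "2 \<le> k" "2 ^ m * ln (real (k * m)) < real k - 1"
  shows "enat (k * m) \<le> kary_h k"
  unfolding kary_h_def
proof (rule Inf_greatest, clarify)
  fix n
  assume "\<forall>T :: (nat, nat \<times> nat) pre_digraph.
    tournament T \<and> n \<le> card (verts T) \<longrightarrow> has_kary_spanning_tree k T"
  then show "enat (k * m) \<le> enat n"
    using ex_tournament_no_kary_spanning_tree[OF assms] by (metis enat_ord_simps(1) nat_le_linear)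
qed

text \<open>This trivial bound serves the finitely many \<open>k\<close> below the asymptotic
  range.\<close>

lemma kary_h_ge_1: "1 \<le> kary_h k"
  unfolding kary_h_def by (rule Inf_greatest) (auto simp: one_enat_def)

text \<open>Taking \<open>m\<close> as half the binary logarithm of \<open>k\<close>, rounded down,
  gives \<open>2 ^ m \<le> sqrt k\<close> and \<open>ln (k * m) \<le> 2 * ln k\<close>, so the
  condition of \<open>kary_h_ge\<close> holds for large \<open>k\<close>, while \<open>k * m\<close>
  has order \<open>k * ln k\<close>.\<close>

lemma eventually_kary_h_ge:
  "\<forall>\<^sub>F k in sequentially. ereal (1 / 8 * real k * ln (real k)) \<le> ereal_of_enat (kary_h k)"
proof -
  \<comment> \<open>Through \<open>ln k / 2 - 1 \<le> m\<close>, the first bound yields both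
    \<open>1 \<le> m\<close> and \<open>ln k / 8 \<le> m\<close>.\<close>
  have "\<forall>\<^sub>F k in sequentially. 4 \<le> ln (real k)"
    "\<forall>\<^sub>F k in sequentially. real k powr (1 / 2) * (2 * ln (real k)) < real k - 1"
    by real_asymp+
  then show ?thesis
    using eventually_ge_at_top[of 4]
  proof eventually_elim
    case (elim k)
    define m where "m = nat \<lfloor>log 2 (real k) / 2\<rfloor>"
    have "ln (real k) \<le> log 2 (real k)"
      using elim(1) ln_2_less_1 by (simp add: log_def le_divide_eq mult_left_le)
    then have m: "real m \<le> log 2 (real k) / 2" "ln (real k) / 2 - 1 \<le> real m"
      using elim(1) unfolding m_def by linarith+
    then have "1 \<le> m" using elim(1) by linarith
    have "log 2 (real k) \<le> real k"
      using elim(3) less_exp[of k] by (simp add: log_le_iff powr_realpow flip: of_nat_power)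
    then have "m \<le> k" using m by linarith
    have "2 ^ m = 2 powr real m" by (simp add: powr_realpow)
    also have "\<dots> \<le> 2 powr (log 2 (real k) * (1 / 2))" using m by simp
    also have "\<dots> = real k powr (1 / 2)" using elim(3) unfolding powr_powr[symmetric] by simp
    finally have "2 ^ m \<le> real k powr (1 / 2)" .
    moreover have "ln (real (k * m)) \<le> 2 * ln (real k)"
      using \<open>1 \<le> m\<close> \<open>m \<le> k\<close> elim(3) by (simp add: ln_mult)
    moreover have "0 \<le> ln (real (k * m))"
      using \<open>1 \<le> m\<close> elim(3) by (intro ln_ge_zero) (simp flip: of_nat_mult)
    ultimately have "2 ^ m * ln (real (k * m)) < real k - 1"
      using elim(2) by (meson le_less_trans mult_mono powr_ge_zero)
    then have "enat (k * m) \<le> kary_h k"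
      using \<open>1 \<le> m\<close> elim(3) by (intro kary_h_ge) auto
    then have "ereal (real (k * m)) \<le> ereal_of_enat (kary_h k)"
      by (metis ereal_of_enat_le_iff ereal_of_enat_simps(1))
    moreover have "1 / 8 * ln (real k) \<le> real m" using elim(1) m by linarith
    then have "real k * (1 / 8 * ln (real k)) \<le> real k * real m" by (intro mult_left_mono) auto
    then have "1 / 8 * real k * ln (real k) \<le> real (k * m)" by (simp add: mult_ac)
    ultimately show ?case by (meson ereal_less_eq(3) order_trans)
  qed
qed

theorem theorem1p2:
  shows "\<exists>c::real. 0 < c \<and>
    (\<forall>k::nat. 4 \<le> k \<longrightarrow> ereal (c * real k * ln (real k)) \<le> ereal_of_enat (kary_h k))"
proof -
  obtain K where K: "\<And>k. K \<le> k \<Longrightarrow> ereal (1 / 8 * real k * ln (real k)) \<le> ereal_of_enat (kary_h k)"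
    using eventually_kary_h_ge unfolding eventually_sequentially by blast
  \<comment> \<open>\<open>M\<close> bounds \<open>k * ln k\<close> for all
    \<open>4 \<le> k < K\<close>; the shift by 4 keeps it positive even for
    \<open>K = 0\<close>.\<close>
  define M where "M = real (K + 4) * ln (real (K + 4))"
  have "0 < M" by (simp add: M_def)
  \<comment> \<open>The value \<open>1 / 8\<close> serves \<open>k \<ge> K\<close>; for smaller
    \<open>k\<close> the value \<open>1 / M\<close> brings \<open>c * k * ln k\<close> down to at
    most 1.\<close>
  define c where "c = min (1 / 8) (1 / M)"
  have "0 < c" using \<open>0 < M\<close> by (simp add: c_def)
  moreover have "ereal (c * real k * ln (real k)) \<le> ereal_of_enat (kary_h k)" if "4 \<le> k" for k
  proof (cases "K \<le> k")
    case True
    have "c * (real k * ln (real k)) \<le> 1 / 8 * (real k * ln (real k))"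
      using that by (intro mult_right_mono) (auto simp: c_def)
    then have "ereal (c * real k * ln (real k)) \<le> ereal (1 / 8 * real k * ln (real k))"
      by (simp add: mult.assoc)
    then show ?thesis using K[OF True] by (rule order_trans)
  next
    case False
    have "real k * ln (real k) \<le> M"
      unfolding M_def using False that by (intro mult_mono ln_mono) auto
    then have "c * (real k * ln (real k)) \<le> 1 / M * M"
      using \<open>0 < c\<close> \<open>0 < M\<close> that by (intro mult_mono) (auto simp: c_def)
    then have "ereal (c * real k * ln (real k)) \<le> 1"
      using \<open>0 < M\<close> by (simp add: mult.assoc)
    also have "1 \<le> ereal_of_enat (kary_h k)"
      using kary_h_ge_1[of k] by (metis ereal_of_enat_le_iff ereal_of_enat_simps(1) one_enat_def of_nat_1 one_ereal_def)
    finally show ?thesis .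
  qed
  ultimately show ?thesis by blast
qed

end
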